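(* Let $R$ be a nonzero commutative ring with identity, let $n\geq 3$ be an integer, and let $\sigma\in GL_n(R)$. Then there exist nonidentity transvections $\tau_1,\tau_2\in GL_n(R)$ such that $\big[[\sigma,\tau_1],\tau_2\big]=I_n$.
   Context: $GL_n(R)$ is the group of invertible $n\times n$ matrices over $R$, acting on $V=R^n$, and $I_n$ is the identity matrix. The commutator convention is $[g,h]=ghg^{-1}h^{-1}$ for $g,h\in GL_n(R)$. Let $V^*=\operatorname{Hom}_R(V,R)$. For $u\in V$ and $f\in V^*$, the operator $u\otimes f\in\operatorname{End}_R(V)$ is defined by $(u\otimes f)(x)=f(x)u$ for $x\in V$. An element $\tau\in GL_n(R)$ is called a transvection if $\tau=I_n+u\otimes f$ for some $u\in V$ and $f\in V^*$ satisfying $f(u)=0$ and $u\otimes f\neq 0$. *)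

theory Defs
  imports "HOL-Analysis.Analysis"
begin

definition GL :: "('a::comm_ring_1 ^ 'n ^ 'n) set" where
  "GL = {A. invertible A}"

(* Meaningful for invertible arguments; matrix_inv is then the unique two-sided inverse. *)
definition mat_commutator ::
    "'a::comm_ring_1 ^ 'n ^ 'n \<Rightarrow> 'a ^ 'n ^ 'n \<Rightarrow> 'a ^ 'n ^ 'n" where
  "mat_commutator g h = g ** h ** matrix_inv g ** matrix_inv h"

(* The dual module Hom_R(R^n, R), with R acting on itself by multiplication. *)
definition dual_module :: "('a::comm_ring_1 ^ 'n \<Rightarrow> 'a) set" where
  "dual_module = {f. module_hom (*s) (*) f}"

definition tensor_op ::
    "'a::comm_ring_1 ^ 'n \<Rightarrow> ('a ^ 'n \<Rightarrow> 'a) \<Rightarrow> 'a ^ 'n \<Rightarrow> 'a ^ 'n"  (infix "\<otimes>\<^sub>o" 75) where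
  "u \<otimes>\<^sub>o f = (\<lambda>x. f x *s u)"

(* End_R(R^n) is identified with n by n matrices through the library's matrix,
   taken with respect to the standard basis; see tensor_op_matrix_works below. *)
definition transvection :: "'a::comm_ring_1 ^ 'n ^ 'n \<Rightarrow> bool" where
  "transvection \<tau> \<longleftrightarrow> \<tau> \<in> GL \<and>
     (\<exists>u. \<exists>f \<in> dual_module.
        f u = 0 \<and> u \<otimes>\<^sub>o f \<noteq> (\<lambda>x. 0) \<and> \<tau> = mat 1 + matrix (u \<otimes>\<^sub>o f))"

lemma module_vec: "module ((*s) :: 'a::comm_ring_1 \<Rightarrow> 'a ^ 'n \<Rightarrow> 'a ^ 'n)"
  by unfold_locales (simp_all add: vec_eq_iff algebra_simps)

lemma module_self: "module ((*) :: 'a::comm_ring_1 \<Rightarrow> 'a \<Rightarrow> 'a)"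
  by unfold_locales (simp_all add: algebra_simps)

lemma dual_module_iff:
  "f \<in> dual_module \<longleftrightarrow> (\<forall>x y. f (x + y) = f x + f y) \<and> (\<forall>r x. f (r *s x) = r * f x)"
  by (simp add: dual_module_def module_hom_def module_hom_axioms_def module_vec module_self)

lemma dual_module_expand:
  fixes f :: "'a::comm_ring_1 ^ 'n \<Rightarrow> 'a"
  assumes "f \<in> dual_module"
  shows "f x = (\<Sum>j\<in>UNIV. x $ j * f (axis j 1))"
proof -
  interpret module_hom "(*s)" "(*)" f
    using assms by (simp add: dual_module_def)
  have "f x = f (\<Sum>j\<in>UNIV. x $ j *s axis j 1)"
    by (simp add: basis_expansion)
  also have "\<dots> = (\<Sum>j\<in>UNIV. x $ j * f (axis j 1))"
    by (simp add: sum scale)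
  finally show ?thesis .
qed

lemma tensor_op_matrix_works:
  fixes f :: "'a::comm_ring_1 ^ 'n \<Rightarrow> 'a"
  assumes "f \<in> dual_module"
  shows "matrix (u \<otimes>\<^sub>o f) *v x = (u \<otimes>\<^sub>o f) x"
  by (simp add: vec_eq_iff matrix_def matrix_vector_mult_def tensor_op_def
      dual_module_expand[OF assms, of x] sum_distrib_left mult_ac)

end

theory Submission
  imports Defs
begin

text \<open>
  Everything reduces to a single square matrix \<open>A \<noteq> 0\<close> with \<open>A ** A = 0\<close> and
  \<open>A ** \<sigma> ** A = 0\<close>.  Put \<open>C = \<sigma> ** A\<close>, so that \<open>C ** C = 0\<close> as well, and take
  \<open>\<tau>\<^sub>1 = 1 + A\<close>, \<open>\<tau>\<^sub>2 = 1 + C\<close>.  The matrix \<open>C\<close> annihilates, from both sides, \<open>A\<close> and also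
  the conjugate \<open>B = \<sigma> ** A ** \<sigma>\<^sup>-\<^sup>1\<close>:
  in each of the products \<open>AC\<close>, \<open>CA\<close>, \<open>BC\<close>, \<open>CB\<close> one of the two vanishing products appears.
  Therefore \<open>C\<close> is unchanged by multiplication on either side with
  \<open>[\<sigma>, \<tau>\<^sub>1] = (1 + B) ** (1 - A)\<close>, and \<open>\<tau>\<^sub>2\<close> commutes with this commutator.

  To find \<open>A\<close>, let \<open>A = u \<otimes> f\<close> for a standard basis vector \<open>u\<close>.  The two conditions
  become \<open>f u = 0\<close> and \<open>f (\<sigma> u) = 0\<close>, and \<open>C = \<sigma> u \<otimes> f\<close>.  This asks for a nonzero functional in
  the remaining, at least two, coordinates that vanishes at one given vector, which exists over every
  commutative ring: use \<open>b x - a y\<close> for a vector with entries \<open>(a, b) \<noteq> (0, 0)\<close>,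
  and a coordinate otherwise.  Choosing \<open>u\<close> to be a basis vector
  guarantees \<open>u \<otimes> f \<noteq> 0\<close> despite possible zero divisors, and then \<open>C \<noteq> 0\<close> because \<open>\<sigma>\<close> is
  invertible.
\<close>

lemma matrix_inv_eqI:
  fixes A B :: "'a::comm_ring_1 ^ 'n ^ 'n"
  assumes "A ** B = mat 1" "B ** A = mat 1"
  shows "matrix_inv A = B"
proof -
  have "A ** matrix_inv A = mat 1 \<and> matrix_inv A ** A = mat 1"
    unfolding matrix_inv_def by (rule someI[of _ B]) (use assms in simp)
  then have "B = B ** (A ** matrix_inv A)"
    by simp
  also have "\<dots> = matrix_inv A"
    by (simp add: matrix_mul_assoc assms(2))
  finally show ?thesis ..
qed

lemma invertible_matrix_invE:
  fixes A :: "'a::comm_ring_1 ^ 'n ^ 'n"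
  assumes "invertible A"
  shows "A ** matrix_inv A = mat 1" "matrix_inv A ** A = mat 1"
  using assms matrix_inv_eqI unfolding invertible_def by blast+

lemma invertible_mat_inv:
  fixes A :: "'a::comm_ring_1 ^ 'n ^ 'n"
  assumes "invertible A"
  shows "invertible (matrix_inv A)"
  using invertible_matrix_invE[OF assms] unfolding invertible_def by blast

lemma mat_commutator_eq_1_if_commute:
  fixes g h :: "'a::comm_ring_1 ^ 'n ^ 'n"
  assumes "invertible g" "invertible h" "g ** h = h ** g"
  shows "mat_commutator g h = mat 1"
proof -
  have "mat_commutator g h = h ** (g ** matrix_inv g) ** matrix_inv h"
    unfolding mat_commutator_def by (simp add: assms(3) matrix_mul_assoc)
  then show ?thesis
    using assms by (simp add: invertible_matrix_invE)
qed

lemma invertible_mat_commutator: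
  fixes g h :: "'a::comm_ring_1 ^ 'n ^ 'n"
  assumes "invertible g" "invertible h"
  shows "invertible (mat_commutator g h)"
  unfolding mat_commutator_def using assms by (intro invertible_mult invertible_mat_inv)

lemma square_zero_inverse:
  fixes A :: "'a::comm_ring_1 ^ 'n ^ 'n"
  assumes "A ** A = 0"
  shows "(mat 1 + A) ** (mat 1 - A) = mat 1" "(mat 1 - A) ** (mat 1 + A) = mat 1"
proof -
  have A2: "A *v (A *v x) = 0" for x
    by (simp add: matrix_vector_mul_assoc assms)
  show "(mat 1 + A) ** (mat 1 - A) = mat 1" "(mat 1 - A) ** (mat 1 + A) = mat 1"
    by (simp_all add: matrix_eq matrix_vector_mul_assoc[symmetric] algebra_simps A2)
qed

lemma invertible_1_plus_square_zero:
  fixes A :: "'a::comm_ring_1 ^ 'n ^ 'n"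
  assumes "A ** A = 0"
  shows "invertible (mat 1 + A)"
  using square_zero_inverse[OF assms] unfolding invertible_def by blast

text \<open>
  With \<open>B = \<sigma> ** A ** \<sigma>\<^sup>-\<^sup>1\<close> and \<open>C = \<sigma> ** A\<close> the commutator is \<open>(1 + B) ** (1 - A)\<close>, and
  \<open>A ** C = A ** \<sigma> ** A\<close>, \<open>C ** A = \<sigma> ** A ** A\<close>, \<open>B ** C = \<sigma> ** A ** A\<close>,
  \<open>C ** B = \<sigma> ** (A ** \<sigma> ** A) ** \<sigma>\<^sup>-\<^sup>1\<close> are all zero.
\<close>

lemma mat_commutator_commutes_square_zero:
  fixes \<sigma> A :: "'a::comm_ring_1 ^ 'n ^ 'n"
  assumes "invertible \<sigma>" "A ** A = 0" "A ** \<sigma> ** A = 0"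
  shows "mat_commutator (mat_commutator \<sigma> (mat 1 + A)) (mat 1 + \<sigma> ** A) = mat 1"
proof -
  let ?T = "mat_commutator \<sigma> (mat 1 + A)"
  have A2: "A *v (A *v x) = 0" and AsA: "A *v (\<sigma> *v (A *v x)) = 0" for x
    by (simp_all add: matrix_vector_mul_assoc matrix_mul_assoc assms)
  have inv: "\<sigma> *v (matrix_inv \<sigma> *v x) = x" "matrix_inv \<sigma> *v (\<sigma> *v x) = x" for x
    by (simp_all add: matrix_vector_mul_assoc invertible_matrix_invE assms(1))
  have T: "?T = \<sigma> ** (mat 1 + A) ** matrix_inv \<sigma> ** (mat 1 - A)"
    unfolding mat_commutator_def
    using square_zero_inverse[OF assms(2)] by (simp add: matrix_inv_eqI)
  have comm: "?T ** (mat 1 + \<sigma> ** A) = (mat 1 + \<sigma> ** A) ** ?T"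
    unfolding T
    by (simp add: matrix_eq matrix_vector_mul_assoc[symmetric] algebra_simps A2 AsA inv)
  have "invertible ?T"
    using assms by (intro invertible_mat_commutator invertible_1_plus_square_zero)
  moreover have "(\<sigma> ** A) ** (\<sigma> ** A) = 0"
    by (simp add: matrix_eq matrix_vector_mul_assoc[symmetric] AsA)
  ultimately show ?thesis
    using comm by (intro mat_commutator_eq_1_if_commute invertible_1_plus_square_zero)
qed

lemma matrix_tensor_op_mult_vec:
  fixes f :: "'a::comm_ring_1 ^ 'n \<Rightarrow> 'a"
  assumes "f \<in> dual_module"
  shows "matrix (u \<otimes>\<^sub>o f) *v x = f x *s u"
  unfolding tensor_op_matrix_works[OF assms] unfolding tensor_op_def ..

lemma matrix_mult_tensor_op:
  fixes f :: "'a::comm_ring_1 ^ 'n \<Rightarrow> 'a"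
  assumes "f \<in> dual_module"
  shows "M ** matrix (u \<otimes>\<^sub>o f) = matrix ((M *v u) \<otimes>\<^sub>o f)"
  by (simp add: matrix_eq matrix_vector_mul_assoc[symmetric]
      matrix_tensor_op_mult_vec[OF assms])
     (simp add: matrix_vector_mult_def vec_eq_iff sum_distrib_left mult_ac)

lemma tensor_op_square_zero:
  fixes f :: "'a::comm_ring_1 ^ 'n \<Rightarrow> 'a"
  assumes "f \<in> dual_module" "f u = 0"
  shows "matrix (u \<otimes>\<^sub>o f) ** matrix (u \<otimes>\<^sub>o f) = 0"
  using assms
  by (simp add: matrix_mult_tensor_op matrix_tensor_op_mult_vec matrix_eq)

lemma transvection_tensor_op:
  fixes f :: "'a::comm_ring_1 ^ 'n \<Rightarrow> 'a"
  assumes "f \<in> dual_module" "f u = 0" "matrix (u \<otimes>\<^sub>o f) \<noteq> 0"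
  shows "transvection (mat 1 + matrix (u \<otimes>\<^sub>o f))"
proof -
  have "mat 1 + matrix (u \<otimes>\<^sub>o f) \<in> GL"
    using assms by (simp add: GL_def invertible_1_plus_square_zero tensor_op_square_zero)
  moreover have "u \<otimes>\<^sub>o f \<noteq> (\<lambda>x. 0)"
    using assms(3) by (auto simp: matrix_def vec_eq_iff)
  ultimately show ?thesis
    using assms unfolding transvection_def by blast
qed

text \<open>
  On the two coordinates \<open>j\<close> and \<open>k\<close> the functional is \<open>x $ j * w $ k - x $ k * w $ j\<close>,
  a \<open>2 \<times> 2\<close> minor of the pair \<open>x, w\<close>; it is nonzero unless \<open>w\<close> vanishes
  in both coordinates, and then the coordinate \<open>j\<close> itself will do.
\<close>

lemma nonzero_functional_vanishing:
  fixes w :: "'a::comm_ring_1 ^ 'n" and i :: 'n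
  assumes "CARD('n) \<ge> 3"
  obtains f x where "f \<in> dual_module" "f (axis i 1) = 0" "f w = 0" "f x \<noteq> 0"
proof -
  have "2 \<le> card (UNIV - {i})"
    using assms by simp
  then obtain S where "S \<subseteq> UNIV - {i}" "card S = 2"
    by (meson obtain_subset_with_card_n)
  then obtain j k where jk: "j \<noteq> k" "j \<noteq> i" "k \<noteq> i"
    by (auto simp: card_2_iff)
  show thesis
  proof (cases "w $ j = 0 \<and> w $ k = 0")
    case True
    then show thesis
      using jk by (intro that[of "\<lambda>x. x $ j" "axis j 1"]) (auto simp: dual_module_iff axis_def)
  next
    case False
    let ?f = "\<lambda>x. x $ j * w $ k - x $ k * w $ j"
    have "?f \<in> dual_module" "?f (axis i 1) = 0" "?f w = 0"
      using jk by (simp_all add: dual_module_iff axis_def algebra_simps)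
    moreover have "?f (axis j 1) = w $ k" "?f (axis k 1) = - w $ j"
      using jk by (simp_all add: axis_def)
    ultimately show thesis
      using that False by (metis neg_equal_0_iff_equal)
  qed
qed

theorem theorem2p9:
  fixes \<sigma> :: "'a::comm_ring_1 ^ 'n ^ 'n"
  assumes "CARD('n) \<ge> 3"
    and "\<sigma> \<in> GL"
  shows "\<exists>\<tau>\<^sub>1 \<in> GL. \<exists>\<tau>\<^sub>2 \<in> GL.
           transvection \<tau>\<^sub>1 \<and> \<tau>\<^sub>1 \<noteq> mat 1 \<and>
           transvection \<tau>\<^sub>2 \<and> \<tau>\<^sub>2 \<noteq> mat 1 \<and>
           mat_commutator (mat_commutator \<sigma> \<tau>\<^sub>1) \<tau>\<^sub>2 = mat 1"
proof -
  have inv: "invertible \<sigma>"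
    using assms(2) by (simp add: GL_def)
  obtain i :: 'n where True
    by blast
  define u :: "'a ^ 'n" where "u = axis i 1"
  obtain f x where f: "f \<in> dual_module" "f u = 0" "f (\<sigma> *v u) = 0" "f x \<noteq> 0"
    using nonzero_functional_vanishing[OF assms(1)] unfolding u_def by metis
  let ?A = "matrix (u \<otimes>\<^sub>o f)"
  have sA: "\<sigma> ** ?A = matrix ((\<sigma> *v u) \<otimes>\<^sub>o f)"
    by (rule matrix_mult_tensor_op[OF f(1)])
  have "(?A *v x) $ i \<noteq> 0"
    using f by (simp add: matrix_tensor_op_mult_vec u_def axis_def)
  then have A0: "?A \<noteq> 0"
    by auto
  moreover have "?A = matrix_inv \<sigma> ** (\<sigma> ** ?A)"
    by (simp add: matrix_mul_assoc invertible_matrix_invE inv)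
  ultimately have sA0: "\<sigma> ** ?A \<noteq> 0"
    by auto
  have \<tau>\<^sub>1: "transvection (mat 1 + ?A)"
    by (rule transvection_tensor_op[OF f(1,2) A0])
  have \<tau>\<^sub>2: "transvection (mat 1 + \<sigma> ** ?A)"
    using transvection_tensor_op[OF f(1,3)] sA0 by (simp add: sA)
  have "?A ** (\<sigma> ** ?A) = matrix ((?A *v (\<sigma> *v u)) \<otimes>\<^sub>o f)"
    unfolding sA by (rule matrix_mult_tensor_op[OF f(1)])
  also have "?A *v (\<sigma> *v u) = 0"
    using f by (simp add: matrix_tensor_op_mult_vec)
  also have "matrix (0 \<otimes>\<^sub>o f) = 0"
    by (simp add: tensor_op_def matrix_def vec_eq_iff)
  finally have AsA: "?A ** \<sigma> ** ?A = 0"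
    by (simp only: matrix_mul_assoc)
  have "mat_commutator (mat_commutator \<sigma> (mat 1 + ?A)) (mat 1 + \<sigma> ** ?A) = mat 1"
    by (rule mat_commutator_commutes_square_zero[OF inv tensor_op_square_zero[OF f(1,2)] AsA])
  moreover have "mat 1 + ?A \<in> GL" "mat 1 + \<sigma> ** ?A \<in> GL"
    using \<tau>\<^sub>1 \<tau>\<^sub>2 unfolding transvection_def by blast+
  moreover have "mat 1 + ?A \<noteq> mat 1" "mat 1 + \<sigma> ** ?A \<noteq> mat 1"
    using A0 sA0 by simp_all
  ultimately show ?thesis
    using \<tau>\<^sub>1 \<tau>\<^sub>2 by blast
qed

end
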